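(* Let $ABC$ be a triangle in the Euclidean plane that is not equilateral. Then the nine-point circle of $ABC$ is tangent to the incircle of $ABC$ and to each of the three excircles of $ABC$.
   Context: The nine-point circle of $ABC$ is the circle through the midpoints of the sides of $ABC$, the feet of its altitudes, and the midpoints of the segments joining the orthocenter to the vertices. The incircle is the unique circle internally tangent to the three sides. The excircles are the three circles externally tangent to all three (extended) sides: the excircle opposite a vertex is tangent to the opposite side at a point between its endpoints and to the extensions of the other two sides. Two circles are tangent if they have a common point at which they have the same tangent line. *)

theory Defs
  imports "HOL-Analysis.Analysis"
begin

type_synonym point = "real^2"

definition is_line :: "point set \<Rightarrow> bool" where
  "is_line l \<longleftrightarrow> (\<exists>X Y. X \<noteq> Y \<and> l = affine hull {X, Y})"

definition is_circle :: "point set \<Rightarrow> bool" where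
  "is_circle \<Gamma> \<longleftrightarrow> (\<exists>O' r. r > 0 \<and> \<Gamma> = sphere O' r)"

definition tangent_line_at :: "point set \<Rightarrow> point \<Rightarrow> point set \<Rightarrow> bool" where
  "tangent_line_at \<Gamma> P l \<longleftrightarrow> is_circle \<Gamma> \<and> is_line l \<and> \<Gamma> \<inter> l = {P}"

definition circles_tangent :: "point set \<Rightarrow> point set \<Rightarrow> bool" where
  "circles_tangent \<Gamma> \<Delta> \<longleftrightarrow> (\<exists>P l. tangent_line_at \<Gamma> P l \<and> tangent_line_at \<Delta> P l)"

definition equilateral :: "point \<Rightarrow> point \<Rightarrow> point \<Rightarrow> bool" where
  "equilateral A B C \<longleftrightarrow> dist A B = dist B C \<and> dist B C = dist C A"

text \<open>The first argument is the distinguished vertex: the altitude and its foot belong to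
  \<open>A\<close>, and the excircle below is the one opposite \<open>A\<close>. The definite descriptions
  denote the intended objects when \<open>A\<close>, \<open>B\<close>, \<open>C\<close> are not collinear.\<close>

definition altitude :: "point \<Rightarrow> point \<Rightarrow> point \<Rightarrow> point set" where
  "altitude A B C = {X. orthogonal (X - A) (C - B)}"

definition altitude_foot :: "point \<Rightarrow> point \<Rightarrow> point \<Rightarrow> point" where
  "altitude_foot A B C = (THE F. F \<in> altitude A B C \<and> F \<in> affine hull {B, C})"

definition orthocenter :: "point \<Rightarrow> point \<Rightarrow> point \<Rightarrow> point" where
  "orthocenter A B C =
    (THE H. H \<in> altitude A B C \<and> H \<in> altitude B C A \<and> H \<in> altitude C A B)"

definition nine_point_circle :: "point \<Rightarrow> point \<Rightarrow> point \<Rightarrow> point set" where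
  "nine_point_circle A B C =
    (THE \<Gamma>. is_circle \<Gamma> \<and>
      {midpoint B C, midpoint C A, midpoint A B} \<subseteq> \<Gamma> \<and>
      {altitude_foot A B C, altitude_foot B C A, altitude_foot C A B} \<subseteq> \<Gamma> \<and>
      {midpoint (orthocenter A B C) A, midpoint (orthocenter A B C) B,
       midpoint (orthocenter A B C) C} \<subseteq> \<Gamma>)"

text \<open>Internal tangency: the circle lies in the triangle and touches the line of each side
  at a point of that side.\<close>

definition incircle :: "point \<Rightarrow> point \<Rightarrow> point \<Rightarrow> point set" where
  "incircle A B C =
    (THE \<Gamma>. is_circle \<Gamma> \<and> \<Gamma> \<subseteq> convex hull {A, B, C} \<and>
      (\<exists>P \<in> closed_segment B C. tangent_line_at \<Gamma> P (affine hull {B, C})) \<and>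
      (\<exists>Q \<in> closed_segment C A. tangent_line_at \<Gamma> Q (affine hull {C, A})) \<and>
      (\<exists>R \<in> closed_segment A B. tangent_line_at \<Gamma> R (affine hull {A, B})))"

text \<open>External tangency: the circle does not enter the interior of the triangle. The
  extension of a side is its line with the side itself removed.\<close>

definition excircle :: "point \<Rightarrow> point \<Rightarrow> point \<Rightarrow> point set" where
  "excircle A B C =
    (THE \<Gamma>. is_circle \<Gamma> \<and> \<Gamma> \<inter> interior (convex hull {A, B, C}) = {} \<and>
      (\<exists>P \<in> open_segment B C. tangent_line_at \<Gamma> P (affine hull {B, C})) \<and>
      (\<exists>Q \<in> affine hull {C, A} - closed_segment C A.
        tangent_line_at \<Gamma> Q (affine hull {C, A})) \<and>
      (\<exists>R \<in> affine hull {A, B} - closed_segment A B.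
        tangent_line_at \<Gamma> R (affine hull {A, B})))"

end

theory Submission
  imports Defs
begin

text \<open>Let \<open>s = a + b + c\<close>, let \<open>k\<close> be twice the area, \<open>R\<close> the circumradius and \<open>J\<close> the incenter
  \<open>(aA + bB + cC)/s\<close>; the inradius is \<open>r = k/s\<close>. With the circumcenter as origin the nine-point
  center is \<open>N = (A + B + C)/2\<close>, so \<open>2(N - J)\<close> is the combination of \<open>A, B, C\<close> with
  weights \<open>1 - 2a/s, 1 - 2b/s, 1 - 2c/s\<close>. Expanding its square and using Heron's formula and
  \<open>2kR = abc\<close> gives \<open>|N - J| = |\<rho> - r|\<close> for \<open>\<rho> = abc/(4k) = R/2\<close>. The computation remains valid when
  \<open>a\<close> is replaced by \<open>-a\<close>, which turns \<open>J\<close> into an excenter and \<open>\<rho>\<close> into \<open>-R/2\<close>.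
  Circles with centers \<open>N \<noteq> J\<close> at this distance are tangent. If \<open>N = J\<close>, the nine-point circle is the
  incircle, which then touches each side at its midpoint, and the triangle is equilateral.\<close>

section \<open>Plane geometry in coordinates\<close>

definition cross2 :: "point \<Rightarrow> point \<Rightarrow> real" where
  "cross2 u v = u$1 * v$2 - u$2 * v$1"

lemmas plane_coords = inner_vec_def sum_2 cross2_def

lemma point_eq_iff: "X = Y \<longleftrightarrow> X$1 = Y$1 \<and> X$2 = Y$2" for X Y :: point
  by (simp add: vec_eq_iff forall_2)

lemma dist_sq_inner: "(dist X Y)\<^sup>2 = (X - Y) \<bullet> (X - Y)"
  by (simp add: dist_norm power2_norm_eq_inner)

text \<open>Lagrange's identity in the plane. It converts between lengths, inner products and areas
  throughout.\<close>

lemma inner_cross2_sq: "(u \<bullet> u) * (v \<bullet> v) = (u \<bullet> v)\<^sup>2 + (cross2 u v)\<^sup>2"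
  by (simp add: plane_coords power2_eq_square algebra_simps)

lemma abs_cross2_le: "\<bar>cross2 u v\<bar> \<le> norm u * norm v"
proof (rule power2_le_imp_le)
  show "\<bar>cross2 u v\<bar>\<^sup>2 \<le> (norm u * norm v)\<^sup>2"
    using inner_cross2_sq[of u v] by (simp add: power_mult_distrib power2_norm_eq_inner)
qed simp

text \<open>If the cross product vanished, \<open>C - A\<close> would equal its projection
  \<open>t *\<^sub>R (B - A)\<close>, which puts \<open>C\<close> on the line
  \<open>AB\<close>.\<close>

lemma noncollinear_cross2:
  fixes A B C :: point
  assumes "\<not> collinear {A, B, C}"
  shows "cross2 (B - A) (C - A) \<noteq> 0"
proof
  assume cr: "cross2 (B - A) (C - A) = 0"
  have AB: "A \<noteq> B" using assms by auto
  then have nz: "(B - A) \<bullet> (B - A) \<noteq> 0" by simp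
  define t where "t = (C - A) \<bullet> (B - A) / ((B - A) \<bullet> (B - A))"
  have t: "t * ((B - A) \<bullet> (B - A)) = (C - A) \<bullet> (B - A)"
    using nz by (simp add: t_def)
  have "((B - A) \<bullet> (B - A)) *\<^sub>R (C - A) = ((C - A) \<bullet> (B - A)) *\<^sub>R (B - A)"
    using cr unfolding point_eq_iff
    by (simp add: plane_coords) algebra
  then have "((B - A) \<bullet> (B - A)) *\<^sub>R (C - A) = ((B - A) \<bullet> (B - A)) *\<^sub>R (t *\<^sub>R (B - A))"
    by (simp add: t[symmetric] mult.commute)
  then have "C - A = t *\<^sub>R (B - A)"
    using nz by (metis real_vector.scale_left_imp_eq)
  then have "C = A + t *\<^sub>R (B - A)" by (simp add: algebra_simps)
  then have "C \<in> affine hull {A, B}" unfolding affine_hull_2_alt by blast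
  then show False using assms collinear_3_affine_hull[OF AB] by blast
qed

text \<open>Cramer's rule: the determinant of \<open>p\<close> and \<open>q\<close> kills both
  coordinates of \<open>X - Y\<close>. Uniqueness of circle centers and of the orthocenter rests on
  this.\<close>

lemma eq_if_orthogonal_to_two:
  assumes "cross2 p q \<noteq> 0" "(X - Y) \<bullet> p = 0" "(X - Y) \<bullet> q = 0"
  shows "X = Y"
proof -
  define d where "d = X - Y"
  have "d \<bullet> p = 0" "d \<bullet> q = 0" using assms by (auto simp: d_def)
  then have "cross2 p q * d$1 = 0" "cross2 p q * d$2 = 0"
    unfolding plane_coords inner_real_def by algebra+
  then show ?thesis using assms(1) by (auto simp: point_eq_iff d_def)
qed

text \<open>Barycentric coordinates are ratios of signed areas: \<open>x\<close>, \<open>y\<close>,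
  \<open>z\<close> compare the triangles \<open>BCX\<close>, \<open>CAX\<close>, \<open>ABX\<close>
  with \<open>ABC\<close>. Multiplying by \<open>k\<close> leaves polynomial identities.\<close>

lemma barycentric_cross2:
  assumes k: "k = cross2 (B - A) (C - A)" "k \<noteq> 0"
  defines "x \<equiv> \<lambda>X. cross2 (C - B) (X - B) / k"
    and "y \<equiv> \<lambda>X. cross2 (A - C) (X - C) / k"
    and "z \<equiv> \<lambda>X. cross2 (B - A) (X - A) / k"
  shows "x X + y X + z X = 1" "X = x X *\<^sub>R A + y X *\<^sub>R B + z X *\<^sub>R C"
proof -
  have "k * (x X + y X + z X) = k"
    using k(2) by (simp add: x_def y_def z_def distrib_left) (simp add: k(1) plane_coords algebra_simps)
  then show "x X + y X + z X = 1" using k(2) by simp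
  have "k *\<^sub>R X = k *\<^sub>R (x X *\<^sub>R A + y X *\<^sub>R B + z X *\<^sub>R C)"
    using k(2) unfolding scaleR_add_right scaleR_scaleR
    by (simp add: x_def y_def z_def) (simp add: k(1) plane_coords point_eq_iff algebra_simps)
  then show "X = x X *\<^sub>R A + y X *\<^sub>R B + z X *\<^sub>R C"
    using k(2) by (metis real_vector.scale_left_imp_eq)
qed

text \<open>The left side is affine in the point and vanishes at \<open>B\<close> and
  \<open>C\<close>, so only the weight of \<open>A\<close> contributes.\<close>

lemma cross2_barycentric:
  assumes "x + y + z = 1"
  shows "cross2 (C - B) (x *\<^sub>R A + y *\<^sub>R B + z *\<^sub>R C - B) = x * cross2 (B - A) (C - A)"
proof -
  have x: "x = 1 - y - z" using assms by simp
  show ?thesis unfolding x by (simp add: plane_coords algebra_simps)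
qed

lemma noncollinear_distinct:
  assumes "\<not> collinear {A, B, C}"
  shows "A \<noteq> B" "B \<noteq> C" "C \<noteq> A"
  using assms by (auto simp: insert_commute)

lemma noncollinear_perm:
  assumes "\<not> collinear {A, B, C}"
  shows "\<not> collinear {B, C, A}"
  using assms by (simp add: insert_commute)

section \<open>Tangent lines\<close>

lemma tangent_point_param:
  assumes "tangent_line_at \<Gamma> P (affine hull {X, Y})"
  shows "\<exists>t. P = X + t *\<^sub>R (Y - X)"
  using assms unfolding tangent_line_at_def affine_hull_2_alt by blast

text \<open>Pythagoras: every other point of the line is farther from \<open>O'\<close> than
  \<open>P\<close>.\<close>

lemma tangent_line_at_sphereI:
  fixes X Y :: point
  assumes XY: "X \<noteq> Y" and P: "P \<in> affine hull {X, Y}" and orth: "(O' - P) \<bullet> (Y - X) = 0"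
    and dist: "dist O' P = r" and r: "r > 0"
  shows "tangent_line_at (sphere O' r) P (affine hull {X, Y})"
proof -
  have "Z = P" if Z: "Z \<in> affine hull {X, Y}" "dist O' Z = r" for Z
  proof -
    obtain t where t: "P = X + t *\<^sub>R (Y - X)" using P unfolding affine_hull_2_alt by auto
    obtain u where u: "Z = X + u *\<^sub>R (Y - X)" using Z unfolding affine_hull_2_alt by auto
    have ZP: "Z - P = (u - t) *\<^sub>R (Y - X)" by (simp add: t u algebra_simps)
    have "(dist O' Z)\<^sup>2 = (dist O' P)\<^sup>2 - 2 * ((O' - P) \<bullet> (Z - P)) + (Z - P) \<bullet> (Z - P)"
      unfolding dist_sq_inner by (simp add: inner_diff_left inner_diff_right inner_commute)
    then have "(Z - P) \<bullet> (Z - P) = 0" using Z dist orth by (simp add: ZP)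
    then show ?thesis by simp
  qed
  moreover have "P \<in> sphere O' r" using dist by simp
  ultimately have "sphere O' r \<inter> affine hull {X, Y} = {P}" using P mem_sphere by blast
  then show ?thesis
    unfolding tangent_line_at_def is_circle_def is_line_def using XY r by blast
qed

text \<open>An oblique radius would give the line a second common point with the circle.\<close>

lemma tangent_line_at_sphereD:
  fixes X Y :: point
  assumes XY: "X \<noteq> Y" and tan: "tangent_line_at (sphere O' r) P (affine hull {X, Y})"
  shows "P \<in> affine hull {X, Y}" "dist O' P = r" "(O' - P) \<bullet> (Y - X) = 0"
proof -
  have int: "sphere O' r \<inter> affine hull {X, Y} = {P}"
    using tan by (simp add: tangent_line_at_def)
  then show P: "P \<in> affine hull {X, Y}" and dP: "dist O' P = r" by auto
  obtain t where t: "P = X + t *\<^sub>R (Y - X)" using P unfolding affine_hull_2_alt by auto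
  define c where "c = 2 * ((O' - P) \<bullet> (Y - X)) / ((Y - X) \<bullet> (Y - X))"
  \<comment> \<open>the reflection of \<open>P\<close> in the foot of the perpendicular from \<open>O'\<close>\<close>
  define Z where "Z = P + c *\<^sub>R (Y - X)"
  have nz: "(Y - X) \<bullet> (Y - X) \<noteq> 0" using XY by simp
  have c: "c * ((Y - X) \<bullet> (Y - X)) = 2 * ((O' - P) \<bullet> (Y - X))"
    using nz by (simp add: c_def)
  have "Z = X + (t + c) *\<^sub>R (Y - X)" by (simp add: Z_def t algebra_simps)
  then have Z: "Z \<in> affine hull {X, Y}" unfolding affine_hull_2_alt by blast
  have "(dist O' Z)\<^sup>2 = (dist O' P)\<^sup>2 - 2 * ((O' - P) \<bullet> (Z - P)) + (Z - P) \<bullet> (Z - P)"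
    unfolding dist_sq_inner by (simp add: inner_diff_left inner_diff_right inner_commute)
  also have "\<dots> = (dist O' P)\<^sup>2 + c * (c * ((Y - X) \<bullet> (Y - X)) - 2 * ((O' - P) \<bullet> (Y - X)))"
    by (simp add: Z_def algebra_simps)
  also have "\<dots> = (dist O' P)\<^sup>2" by (simp add: c)
  finally have "dist O' Z = r" using dP by (metis power2_eq_imp_eq zero_le_dist)
  then have "Z \<in> sphere O' r" by simp
  then have "Z = P" using Z int by blast
  then have "c = 0" using XY by (simp add: Z_def)
  then show "(O' - P) \<bullet> (Y - X) = 0" using c by simp
qed

text \<open>The radius \<open>\<rho>\<close> is signed: for positive \<open>\<rho>\<close> the
  distance of the centers is the difference of the radii (internal tangency), for negative
  \<open>\<rho>\<close> it is their sum (external tangency).\<close>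

lemma spheres_tangentI:
  fixes N J :: point
  assumes d: "(dist N J)\<^sup>2 = (\<rho> - r)\<^sup>2" and NJ: "N \<noteq> J" and "r > 0" and "\<rho> \<noteq> 0"
  shows "circles_tangent (sphere N \<bar>\<rho>\<bar>) (sphere J r)"
proof -
  define \<delta> where "\<delta> = \<rho> - r"
  \<comment> \<open>A unit vector on the line of centers. Dividing by the signed
    \<open>\<delta>\<close> makes \<open>N\<close>, \<open>J\<close> and the contact point
    \<open>N + \<rho> *\<^sub>R e\<close> fit one formula for both signs.\<close>
  define e where "e = (1 / \<delta>) *\<^sub>R (J - N)"
  have \<delta>: "\<delta> \<noteq> 0" using d NJ by (auto simp: \<delta>_def)
  have J: "J = N + \<delta> *\<^sub>R e" using \<delta> by (simp add: e_def)
  have "dist N J = \<bar>\<delta>\<bar>" using d by (metis \<delta>_def abs_of_nonneg power2_eq_iff abs_minus_cancel zero_le_dist)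
  then have e: "norm e = 1" using \<delta> by (simp add: e_def dist_norm norm_minus_commute)
  define P where "P = N + \<rho> *\<^sub>R e"
  \<comment> \<open>Adding \<open>e\<close> rotated by a quarter turn gives a second point of the
    common tangent, perpendicular to the line of centers.\<close>
  define Y :: point where "Y = P + vector [- e$2, e$1]"
  have YP: "(Y - P) \<bullet> e = 0" by (simp add: Y_def plane_coords)
  have "P \<noteq> Y" using e by (auto simp: Y_def point_eq_iff norm_vec_def L2_set_def sum_2)
  moreover have "P \<in> affine hull {P, Y}" by (simp add: hull_inc)
  moreover have NP: "N - P = (- \<rho>) *\<^sub>R e" by (simp add: P_def)
  moreover have JP: "J - P = (- r) *\<^sub>R e" by (simp add: P_def J \<delta>_def algebra_simps)
  ultimately have "tangent_line_at (sphere N \<bar>\<rho>\<bar>) P (affine hull {P, Y})"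
    "tangent_line_at (sphere J r) P (affine hull {P, Y})"
    using YP e assms(3,4) by (auto intro!: tangent_line_at_sphereI simp: dist_norm inner_commute)
  then show ?thesis unfolding circles_tangent_def by blast
qed

section \<open>Circles tangent to the three side lines\<close>

text \<open>The incircle and the excircles are treated together: the incircle belongs to the side lengths
  \<open>a, b, c\<close>, and the excircle opposite \<open>A\<close> to the signed lengths \<open>-a, b, c\<close>.\<close>

definition signed_sides :: "point \<Rightarrow> point \<Rightarrow> point \<Rightarrow> real \<Rightarrow> real \<Rightarrow> real \<Rightarrow> bool" where
  "signed_sides A B C a b c \<longleftrightarrow> \<not> collinear {A, B, C} \<and> \<bar>a\<bar> = dist B C \<and> \<bar>b\<bar> = dist C A \<and>
    \<bar>c\<bar> = dist A B \<and> a + b + c > 0"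

definition tri_center :: "point \<Rightarrow> point \<Rightarrow> point \<Rightarrow> real \<Rightarrow> real \<Rightarrow> real \<Rightarrow> point" where
  "tri_center A B C a b c =
    (a / (a + b + c)) *\<^sub>R A + (b / (a + b + c)) *\<^sub>R B + (c / (a + b + c)) *\<^sub>R C"

text \<open>Twice the area over the signed perimeter: the inradius, or for \<open>-a, b, c\<close>
  the exradius opposite \<open>A\<close>.\<close>

definition tri_radius :: "point \<Rightarrow> point \<Rightarrow> point \<Rightarrow> real \<Rightarrow> real \<Rightarrow> real \<Rightarrow> real" where
  "tri_radius A B C a b c = \<bar>cross2 (B - A) (C - A)\<bar> / (a + b + c)"

lemma cross2_rotate:
  "cross2 (C - B) (A - B) = cross2 (B - A) (C - A)" "cross2 (A - C) (B - C) = cross2 (B - A) (C - A)"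
  by (simp_all add: plane_coords algebra_simps)

lemma signed_sides_rotate:
  assumes "signed_sides A B C a b c"
  shows "signed_sides B C A b c a"
  using assms noncollinear_perm unfolding signed_sides_def by (auto simp: algebra_simps)

text \<open>The facts below are proved for the side \<open>BC\<close> only; cyclic relabelling,
  which keeps the circle, carries them to the other two sides.\<close>

lemma tri_rotate:
  "tri_center B C A b c a = tri_center A B C a b c" "tri_center C A B c a b = tri_center A B C a b c"
  "tri_radius B C A b c a = tri_radius A B C a b c" "tri_radius C A B c a b = tri_radius A B C a b c"
  by (simp_all add: tri_center_def tri_radius_def cross2_rotate[where A = A and B = B and C = C] add_ac)

text \<open>Only squares of the sides occur, so the law of cosines does not see their signs.\<close>

lemma signed_sides_sq:
  assumes "signed_sides A B C a b c"
  shows "(C - B) \<bullet> (C - B) = a\<^sup>2" "(C - A) \<bullet> (C - A) = b\<^sup>2" "(B - A) \<bullet> (B - A) = c\<^sup>2"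
    and "2 * ((B - A) \<bullet> (C - A)) = b\<^sup>2 + c\<^sup>2 - a\<^sup>2"
proof -
  have "a\<^sup>2 = (dist B C)\<^sup>2" "b\<^sup>2 = (dist C A)\<^sup>2" "c\<^sup>2 = (dist A B)\<^sup>2"
    using assms unfolding signed_sides_def by (metis power2_abs)+
  then show 1: "(C - B) \<bullet> (C - B) = a\<^sup>2" "(C - A) \<bullet> (C - A) = b\<^sup>2" "(B - A) \<bullet> (B - A) = c\<^sup>2"
    unfolding dist_sq_inner by (simp_all add: inner_diff_left inner_diff_right inner_commute)
  show "2 * ((B - A) \<bullet> (C - A)) = b\<^sup>2 + c\<^sup>2 - a\<^sup>2"
    unfolding 1[symmetric] by (simp add: inner_diff_left inner_diff_right inner_commute)
qed

lemma signed_sides_nonzero: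
  assumes "signed_sides A B C a b c"
  shows "a \<noteq> 0" "b \<noteq> 0" "c \<noteq> 0" "A \<noteq> B" "B \<noteq> C" "C \<noteq> A" "cross2 (B - A) (C - A) \<noteq> 0"
    "tri_radius A B C a b c > 0"
proof -
  show ne: "A \<noteq> B" "B \<noteq> C" "C \<noteq> A"
    using assms noncollinear_distinct[of A B C] by (simp_all add: signed_sides_def)
  then show "a \<noteq> 0" "b \<noteq> 0" "c \<noteq> 0"
    using assms by (auto simp: signed_sides_def)
  show "cross2 (B - A) (C - A) \<noteq> 0"
    using assms noncollinear_cross2 by (simp add: signed_sides_def)
  then show "tri_radius A B C a b c > 0"
    using assms by (simp add: signed_sides_def tri_radius_def)
qed

text \<open>Lagrange's identity combined with the law of cosines, hence valid for signed sides as
  well.\<close>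

lemma heron:
  assumes "signed_sides A B C a b c"
  shows "4 * (cross2 (B - A) (C - A))\<^sup>2 = (a + b + c) * (b + c - a) * (c + a - b) * (a + b - c)"
proof -
  have "4 * (c\<^sup>2 * b\<^sup>2) = (b\<^sup>2 + c\<^sup>2 - a\<^sup>2)\<^sup>2 + 4 * (cross2 (B - A) (C - A))\<^sup>2"
    using inner_cross2_sq[of "B - A" "C - A"] signed_sides_sq[OF assms]
    by (metis (no_types, opaque_lifting) distrib_left four_x_squared)
  then show ?thesis by algebra
qed

text \<open>The contact point is the foot of the perpendicular from \<open>J\<close>: the tangent
  length \<open>(a + c - b) / 2\<close> from \<open>B\<close>, divided by \<open>a\<close>, is its
  parameter. The weight \<open>a / s\<close> of \<open>A\<close> in \<open>J\<close> gives the
  distance \<open>(\<bar>a\<bar> / s) * \<bar>k\<bar> / \<bar>a\<bar>\<close> to \<open>BC\<close>,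
  in which the side cancels.\<close>

lemma tri_center_tangent:
  assumes S: "signed_sides A B C a b c"
  shows "tangent_line_at (sphere (tri_center A B C a b c) (tri_radius A B C a b c))
    (B + ((a + c - b) / (2 * a)) *\<^sub>R (C - B)) (affine hull {B, C})"
proof -
  define s where "s = a + b + c"
  define J where "J = tri_center A B C a b c"
  define t where "t = (a + c - b) / (2 * a)"
  define D where "D = B + t *\<^sub>R (C - B)"
  define k where "k = cross2 (B - A) (C - A)"
  have s: "s > 0" using S by (simp add: signed_sides_def s_def)
  note nz = signed_sides_nonzero[OF S]
  have a: "(C - B) \<bullet> (C - B) = a\<^sup>2" using signed_sides_sq[OF S] by simp
  have ac: "2 * ((A - B) \<bullet> (C - B)) = a\<^sup>2 + c\<^sup>2 - b\<^sup>2"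
    using signed_sides_sq(4)[OF signed_sides_rotate[OF S]] by (simp add: inner_commute)
  have "s *\<^sub>R J = a *\<^sub>R A + b *\<^sub>R B + c *\<^sub>R C"
    using s by (simp add: J_def tri_center_def s_def scaleR_add_right)
  then have "s *\<^sub>R (J - B) = a *\<^sub>R (A - B) + c *\<^sub>R (C - B)"
    by (simp add: algebra_simps s_def)
  then have "s * ((J - B) \<bullet> (C - B)) = a * ((A - B) \<bullet> (C - B)) + c * a\<^sup>2"
    by (metis inner_add_left inner_scaleR_left a)
  then have "2 * (s * ((J - B) \<bullet> (C - B))) = 2 * (a * ((A - B) \<bullet> (C - B)) + c * a\<^sup>2)" by simp
  also have "\<dots> = a * (a\<^sup>2 + c\<^sup>2 - b\<^sup>2) + 2 * c * a\<^sup>2" unfolding ac[symmetric] by (simp add: algebra_simps)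
  also have "\<dots> = s * (a * (a + c - b))" by (simp add: s_def power2_eq_square algebra_simps)
  finally have JB: "2 * ((J - B) \<bullet> (C - B)) = a * (a + c - b)" using s by simp
  have "2 * ((J - D) \<bullet> (C - B)) = 2 * ((J - B) \<bullet> (C - B)) - 2 * t * ((C - B) \<bullet> (C - B))"
    by (simp add: D_def algebra_simps)
  also have "\<dots> = 0" using nz(1) unfolding JB a by (simp add: t_def power2_eq_square)
  finally have orth: "(J - D) \<bullet> (C - B) = 0" by simp
  \<comment> \<open>The area does not depend on where \<open>D\<close> lies on \<open>BC\<close>;
    with a vanishing inner product, Lagrange's identity turns it into the distance from
    \<open>J\<close> to \<open>D\<close>.\<close>
  have "cross2 (J - D) (C - B) = - cross2 (C - B) (J - B)"
    by (simp add: D_def plane_coords algebra_simps)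
  also have "cross2 (C - B) (J - B) = a / s * k"
    unfolding J_def tri_center_def k_def s_def
    by (rule cross2_barycentric) (use s in \<open>simp add: s_def flip: add_divide_distrib\<close>)
  finally have "((J - D) \<bullet> (J - D)) * a\<^sup>2 = (\<bar>k\<bar> / s)\<^sup>2 * a\<^sup>2"
    using inner_cross2_sq[of "J - D" "C - B"] orth a by (simp add: power_mult_distrib power_divide)
  then have "(dist J D)\<^sup>2 = (\<bar>k\<bar> / s)\<^sup>2"
    using nz(1) unfolding dist_sq_inner by (metis mult_right_cancel power_not_zero)
  then have d: "dist J D = tri_radius A B C a b c"
    using s unfolding tri_radius_def k_def s_def
    by (metis abs_ge_zero divide_nonneg_pos power2_eq_imp_eq zero_le_dist)
  have "D \<in> affine hull {B, C}" unfolding D_def affine_hull_2_alt by blast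
  then show ?thesis
    using tangent_line_at_sphereI[OF nz(5) _ orth d nz(8)] by (simp add: D_def t_def J_def)
qed

text \<open>The center has first coordinate \<open>a / s\<close>, and a step of one radius changes
  it by at most \<open>\<bar>a\<bar> / s\<close>. Hence the circle stays on one side of
  \<open>BC\<close>: that of \<open>A\<close> for positive \<open>a\<close>, the opposite one for
  negative \<open>a\<close>.\<close>

lemma tri_center_barycentric:
  assumes S: "signed_sides A B C a b c"
    and X: "X \<in> sphere (tri_center A B C a b c) (tri_radius A B C a b c)"
  shows "\<bar>cross2 (C - B) (X - B) / cross2 (B - A) (C - A) - a / (a + b + c)\<bar> \<le> \<bar>a\<bar> / (a + b + c)"
proof -
  define J where "J = tri_center A B C a b c"
  define k where "k = cross2 (B - A) (C - A)"
  have s: "a + b + c > 0" using S by (simp add: signed_sides_def)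
  have k: "k \<noteq> 0" using signed_sides_nonzero[OF S] by (simp add: k_def)
  have "cross2 (C - B) (X - B) = cross2 (C - B) (J - B) + cross2 (C - B) (X - J)"
    by (simp add: plane_coords algebra_simps)
  also have "cross2 (C - B) (J - B) = a / (a + b + c) * k"
    unfolding J_def tri_center_def k_def
    by (rule cross2_barycentric) (use s in \<open>simp flip: add_divide_distrib\<close>)
  finally have "cross2 (C - B) (X - B) / k - a / (a + b + c) = cross2 (C - B) (X - J) / k"
    using k by (simp add: field_simps)
  moreover have "\<bar>cross2 (C - B) (X - J)\<bar> \<le> \<bar>a\<bar> * (\<bar>k\<bar> / (a + b + c))"
    using abs_cross2_le[of "C - B" "X - J"] X S
    by (simp add: J_def k_def tri_radius_def signed_sides_def dist_norm norm_minus_commute)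
  then have "\<bar>cross2 (C - B) (X - J)\<bar> / \<bar>k\<bar> \<le> \<bar>a\<bar> / (a + b + c)"
    using k by (simp add: pos_divide_le_eq mult.commute)
  ultimately show ?thesis by (simp only: k_def abs_divide)
qed

section \<open>Tangent lengths and uniqueness of a circle with given contact points\<close>

text \<open>Pythagoras in the triangle \<open>O'PZ\<close>. The right side is the power of
  \<open>Z\<close>, the same for every tangent through \<open>Z\<close>.\<close>

lemma tangent_length_sq:
  assumes "X \<noteq> Y" "tangent_line_at (sphere O' r) P (affine hull {X, Y})" "Z \<in> affine hull {X, Y}"
  shows "(dist P Z)\<^sup>2 = (dist O' Z)\<^sup>2 - r\<^sup>2"
proof -
  note T = tangent_line_at_sphereD[OF assms(1,2)]
  obtain t where t: "P = X + t *\<^sub>R (Y - X)" using T(1) unfolding affine_hull_2_alt by auto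
  obtain u where u: "Z = X + u *\<^sub>R (Y - X)" using assms(3) unfolding affine_hull_2_alt by auto
  have "Z - P = (u - t) *\<^sub>R (Y - X)" by (simp add: t u algebra_simps)
  then have "(O' - P) \<bullet> (Z - P) = 0" using T(3) by simp
  moreover have "(dist O' Z)\<^sup>2 = (dist O' P)\<^sup>2 - 2 * ((O' - P) \<bullet> (Z - P)) + (dist P Z)\<^sup>2"
    unfolding dist_sq_inner by (simp add: inner_diff_left inner_diff_right inner_commute)
  ultimately show ?thesis using T(2) by simp
qed

text \<open>Both sides are the tangent length from \<open>B\<close>. The absolute values allow
  contact points outside the sides.\<close>

lemma tangent_lengths_eq:
  fixes A B C :: point
  assumes ne: "A \<noteq> B" "B \<noteq> C"
    and P: "tangent_line_at (sphere O' r) (B + t *\<^sub>R (C - B)) (affine hull {B, C})"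
    and R: "tangent_line_at (sphere O' r) (A + w *\<^sub>R (B - A)) (affine hull {A, B})"
  shows "\<bar>t * dist B C\<bar> = \<bar>dist A B - w * dist A B\<bar>"
proof -
  have "B \<in> affine hull {B, C}" "B \<in> affine hull {A, B}" by (simp_all add: hull_inc)
  then have "(dist (B + t *\<^sub>R (C - B)) B)\<^sup>2 = (dist (A + w *\<^sub>R (B - A)) B)\<^sup>2"
    using tangent_length_sq[OF ne(2) P] tangent_length_sq[OF ne(1) R] by simp
  moreover have "A + w *\<^sub>R (B - A) - B = (1 - w) *\<^sub>R (A - B)" by (simp add: algebra_simps)
  ultimately have "\<bar>t\<bar> * dist B C = \<bar>1 - w\<bar> * dist A B"
    by (simp add: dist_norm norm_minus_commute power2_eq_iff_nonneg)
  moreover have "dist A B - w * dist A B = (1 - w) * dist A B" by (simp add: algebra_simps)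
  ultimately show ?thesis by (simp add: abs_mult)
qed

text \<open>The center lies on the perpendiculars to \<open>BC\<close> at \<open>P\<close> and to
  \<open>CA\<close> at \<open>Q\<close>, which meet only once.\<close>

lemma circle_eq_if_two_contacts:
  fixes A B C :: point
  assumes nc: "\<not> collinear {A, B, C}"
    and "tangent_line_at (sphere X r) P (affine hull {B, C})" "tangent_line_at (sphere X r) Q (affine hull {C, A})"
    and "tangent_line_at (sphere Y r') P (affine hull {B, C})" "tangent_line_at (sphere Y r') Q (affine hull {C, A})"
  shows "sphere X r = sphere Y r'"
proof -
  have ne: "B \<noteq> C" "C \<noteq> A" using noncollinear_distinct[OF nc] by simp_all
  note T = tangent_line_at_sphereD[OF ne(1) assms(2)] tangent_line_at_sphereD[OF ne(2) assms(3)]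
    tangent_line_at_sphereD[OF ne(1) assms(4)] tangent_line_at_sphereD[OF ne(2) assms(5)]
  have "cross2 (C - B) (A - C) \<noteq> 0"
    using noncollinear_cross2[OF noncollinear_perm[OF noncollinear_perm[OF nc]]]
    by (simp add: plane_coords algebra_simps)
  moreover have "(X - Y) \<bullet> (C - B) = 0" "(X - Y) \<bullet> (A - C) = 0"
    using T(3,6,9,12) by (simp_all add: inner_diff_left)
  ultimately have "X = Y" by (rule eq_if_orthogonal_to_two)
  then show ?thesis using T(2,8) by simp
qed

lemma segment_point_iff:
  fixes X Y :: "'a::real_vector"
  assumes "X \<noteq> Y"
  shows "X + t *\<^sub>R (Y - X) \<in> closed_segment X Y \<longleftrightarrow> 0 \<le> t \<and> t \<le> 1"
    and "X + t *\<^sub>R (Y - X) \<in> open_segment X Y \<longleftrightarrow> 0 < t \<and> t < 1"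
proof -
  have eq: "X + t *\<^sub>R (Y - X) = (1 - u) *\<^sub>R X + u *\<^sub>R Y \<longleftrightarrow> t = u" for u
  proof -
    have "X + t *\<^sub>R (Y - X) - ((1 - u) *\<^sub>R X + u *\<^sub>R Y) = (t - u) *\<^sub>R (Y - X)"
      by (simp add: algebra_simps)
    then show ?thesis using assms
      by (metis eq_iff_diff_eq_0 scaleR_eq_0_iff)
  qed
  show "X + t *\<^sub>R (Y - X) \<in> closed_segment X Y \<longleftrightarrow> 0 \<le> t \<and> t \<le> 1"
    by (auto simp: in_segment(1) eq)
  show "X + t *\<^sub>R (Y - X) \<in> open_segment X Y \<longleftrightarrow> 0 < t \<and> t < 1"
    using assms by (auto simp: in_segment(2) eq)
qed

section \<open>Identification of the incircle and the excircle\<close>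

text \<open>Existence combines the contact points and barycentric bounds of all three sides. For
  uniqueness, equal tangent lengths determine the contact points and these determine the
  circle.\<close>

lemma incircle_eq:
  assumes S: "signed_sides A B C a b c" and pos: "a > 0" "b > 0" "c > 0"
  shows "incircle A B C = sphere (tri_center A B C a b c) (tri_radius A B C a b c)"
  unfolding incircle_def
proof (rule the_equality)
  let ?\<Gamma> = "sphere (tri_center A B C a b c) (tri_radius A B C a b c)"
  note S' = signed_sides_rotate[OF S] and S'' = signed_sides_rotate[OF signed_sides_rotate[OF S]]
  note nz = signed_sides_nonzero[OF S]
  note T = tri_center_tangent[OF S] tri_center_tangent[OF S'] tri_center_tangent[OF S'']
  note rot = tri_rotate[where A = A and B = B and C = C and a = a and b = b and c = c]
  note T = T[unfolded rot]
  have d: "dist B C = a" "dist C A = b" "dist A B = c"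
    using S pos unfolding signed_sides_def by linarith+
  have tri: "a \<le> b + c" "b \<le> c + a" "c \<le> a + b"
    using dist_triangle[of B C A] dist_triangle[of C A B] dist_triangle[of A B C] d
    by (simp_all add: dist_commute)
  have nc: "\<not> collinear {A, B, C}" using S by (simp add: signed_sides_def)
  show "is_circle ?\<Gamma> \<and> ?\<Gamma> \<subseteq> convex hull {A, B, C} \<and>
      (\<exists>P\<in>closed_segment B C. tangent_line_at ?\<Gamma> P (affine hull {B, C})) \<and>
      (\<exists>Q\<in>closed_segment C A. tangent_line_at ?\<Gamma> Q (affine hull {C, A})) \<and>
      (\<exists>R\<in>closed_segment A B. tangent_line_at ?\<Gamma> R (affine hull {A, B}))"
  proof (intro conjI)
    show "is_circle ?\<Gamma>" using T(1) by (simp add: tangent_line_at_def)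
    show "?\<Gamma> \<subseteq> convex hull {A, B, C}"
    proof
      fix X assume X: "X \<in> ?\<Gamma>"
      define k where "k = cross2 (B - A) (C - A)"
      have nonneg: "0 \<le> x" if "\<bar>x - p / q\<bar> \<le> \<bar>p\<bar> / q" "p > 0" for x p q :: real
        using that by simp
      have "0 \<le> cross2 (C - B) (X - B) / k"
        using tri_center_barycentric[OF S X] nonneg pos unfolding k_def by blast
      moreover have "0 \<le> cross2 (A - C) (X - C) / k"
        using tri_center_barycentric[OF S', unfolded rot, OF X] nonneg pos
        unfolding k_def cross2_rotate[where A = A and B = B and C = C] by blast
      moreover have "0 \<le> cross2 (B - A) (X - A) / k"
        using tri_center_barycentric[OF S'', unfolded rot, OF X] nonneg pos
        unfolding k_def cross2_rotate[where A = A and B = B and C = C] by blast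
      ultimately show "X \<in> convex hull {A, B, C}"
        using barycentric_cross2[OF k_def, of X] nz(7) unfolding convex_hull_3 k_def[symmetric] by blast
    qed
    show "\<exists>P\<in>closed_segment B C. tangent_line_at ?\<Gamma> P (affine hull {B, C})"
      by (rule bexI, rule T(1)) (use pos tri in \<open>simp only: segment_point_iff nz not_False_eq_True, simp add: field_simps\<close>)
    show "\<exists>P\<in>closed_segment C A. tangent_line_at ?\<Gamma> P (affine hull {C, A})"
      by (rule bexI, rule T(2)) (use pos tri in \<open>simp only: segment_point_iff nz not_False_eq_True, simp add: field_simps\<close>)
    show "\<exists>P\<in>closed_segment A B. tangent_line_at ?\<Gamma> P (affine hull {A, B})"
      by (rule bexI, rule T(3)) (use pos tri in \<open>simp only: segment_point_iff nz not_False_eq_True, simp add: field_simps\<close>)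
  qed
  fix \<Gamma> assume \<Gamma>: "is_circle \<Gamma> \<and> \<Gamma> \<subseteq> convex hull {A, B, C} \<and>
      (\<exists>P\<in>closed_segment B C. tangent_line_at \<Gamma> P (affine hull {B, C})) \<and>
      (\<exists>Q\<in>closed_segment C A. tangent_line_at \<Gamma> Q (affine hull {C, A})) \<and>
      (\<exists>R\<in>closed_segment A B. tangent_line_at \<Gamma> R (affine hull {A, B}))"
  then obtain O' r where G: "\<Gamma> = sphere O' r" unfolding is_circle_def by blast
  obtain P Q R where P: "P \<in> closed_segment B C" "tangent_line_at \<Gamma> P (affine hull {B, C})"
    and Q: "Q \<in> closed_segment C A" "tangent_line_at \<Gamma> Q (affine hull {C, A})"
    and R: "R \<in> closed_segment A B" "tangent_line_at \<Gamma> R (affine hull {A, B})"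
    using \<Gamma> by blast
  obtain t u w where P': "P = B + t *\<^sub>R (C - B)" and Q': "Q = C + u *\<^sub>R (A - C)"
    and R': "R = A + w *\<^sub>R (B - A)"
    using P(2) Q(2) R(2) tangent_point_param by metis
  note tan = P(2)[unfolded P' G] Q(2)[unfolded Q' G] R(2)[unfolded R' G]
  have "0 \<le> t \<and> t \<le> 1" "0 \<le> u \<and> u \<le> 1" "0 \<le> w \<and> w \<le> 1"
    using P(1) Q(1) R(1) nz by (simp_all add: P' Q' R' segment_point_iff)
  then have "0 \<le> t * a \<and> t * a \<le> a" "0 \<le> u * b \<and> u * b \<le> b" "0 \<le> w * c \<and> w * c \<le> c"
    using pos by simp_all
  moreover have "\<bar>t * a\<bar> = \<bar>c - w * c\<bar>" "\<bar>u * b\<bar> = \<bar>a - t * a\<bar>" "\<bar>w * c\<bar> = \<bar>b - u * b\<bar>"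
    using tangent_lengths_eq[OF nz(4,5) tan(1,3)] tangent_lengths_eq[OF nz(5,6) tan(2,1)]
      tangent_lengths_eq[OF nz(6,4) tan(3,2)] by (simp_all add: d)
  \<comment> \<open>Contact points on the closed sides make every absolute value that of a
    nonnegative number; the remaining linear system has one solution.\<close>
  ultimately have "2 * (t * a) = a + c - b" "2 * (u * b) = b + a - c" by linarith+
  then have "t = (a + c - b) / (2 * a)" "u = (b + a - c) / (2 * b)" using pos by (simp_all add: field_simps)
  then show "\<Gamma> = ?\<Gamma>"
    unfolding G using circle_eq_if_two_contacts[OF nc tan(1,2)] T(1,2) by simp
qed

lemma excircle_eq:
  assumes S: "signed_sides A B C (-a) b c" and pos: "a > 0" "b > 0" "c > 0"
  shows "excircle A B C = sphere (tri_center A B C (-a) b c) (tri_radius A B C (-a) b c)"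
  unfolding excircle_def
proof (rule the_equality)
  let ?\<Gamma> = "sphere (tri_center A B C (-a) b c) (tri_radius A B C (-a) b c)"
  note S' = signed_sides_rotate[OF S] and S'' = signed_sides_rotate[OF signed_sides_rotate[OF S]]
  note nz = signed_sides_nonzero[OF S]
  note T = tri_center_tangent[OF S] tri_center_tangent[OF S'] tri_center_tangent[OF S'']
  note rot = tri_rotate[where A = A and B = B and C = C and a = "-a" and b = b and c = c]
  note T = T[unfolded rot]
  have d: "dist B C = a" "dist C A = b" "dist A B = c"
    using S pos unfolding signed_sides_def by linarith+
  have nc: "\<not> collinear {A, B, C}" and s: "a < b + c"
    using S by (simp_all add: signed_sides_def)
  \<comment> \<open>Equality would annihilate a factor in Heron's formula. Strictness puts one
    contact point inside \<open>BC\<close> and the other two off the closed sides.\<close>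
  have "c + a \<noteq> b" "a + b \<noteq> c" using heron[OF S] nz(7) by auto
  then have tri: "b < c + a" "c < a + b"
    using dist_triangle[of C A B] dist_triangle[of A B C] d
    by (simp_all add: dist_commute)
  show "is_circle ?\<Gamma> \<and> ?\<Gamma> \<inter> interior (convex hull {A, B, C}) = {} \<and>
      (\<exists>P\<in>open_segment B C. tangent_line_at ?\<Gamma> P (affine hull {B, C})) \<and>
      (\<exists>Q\<in>affine hull {C, A} - closed_segment C A. tangent_line_at ?\<Gamma> Q (affine hull {C, A})) \<and>
      (\<exists>R\<in>affine hull {A, B} - closed_segment A B. tangent_line_at ?\<Gamma> R (affine hull {A, B}))"
  proof (intro conjI)
    show "is_circle ?\<Gamma>" using T(1) by (simp add: tangent_line_at_def)
    \<comment> \<open>The coordinate belonging to \<open>A\<close> is positive inside the triangle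
      but at most zero on the circle.\<close>
    have False if X: "X \<in> ?\<Gamma>" "X \<in> interior (convex hull {A, B, C})" for X
    proof -
      obtain x y z where xyz: "0 < x" "x + y + z = 1" "X = x *\<^sub>R A + y *\<^sub>R B + z *\<^sub>R C"
        using X(2) unfolding interior_convex_hull_3_minimal[OF nc, simplified] by blast
      have "cross2 (C - B) (X - B) / cross2 (B - A) (C - A) = x"
        using cross2_barycentric[OF xyz(2)] nz(7) by (simp add: xyz(3))
      then have "\<bar>x + a / (- a + b + c)\<bar> \<le> a / (- a + b + c)"
        using tri_center_barycentric[OF S X(1)] pos by simp
      then show False using xyz(1) by linarith
    qed
    then show "?\<Gamma> \<inter> interior (convex hull {A, B, C}) = {}" by blast
    show "\<exists>P\<in>open_segment B C. tangent_line_at ?\<Gamma> P (affine hull {B, C})"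
      by (rule bexI, rule T(1)) (use pos tri in \<open>simp only: segment_point_iff nz not_False_eq_True, simp add: field_simps\<close>)
    have aff: "X + t *\<^sub>R (Y - X) \<in> affine hull {X, Y}" for X Y :: point and t
      unfolding affine_hull_2_alt by blast
    show "\<exists>P\<in>affine hull {C, A} - closed_segment C A. tangent_line_at ?\<Gamma> P (affine hull {C, A})"
      by (rule bexI, rule T(2)) (use pos tri in \<open>simp only: Diff_iff segment_point_iff nz aff not_False_eq_True, simp add: field_simps\<close>)
    show "\<exists>P\<in>affine hull {A, B} - closed_segment A B. tangent_line_at ?\<Gamma> P (affine hull {A, B})"
      by (rule bexI, rule T(3)) (use pos tri in \<open>simp only: Diff_iff segment_point_iff nz aff not_False_eq_True, simp add: field_simps\<close>)
  qed
  fix \<Gamma> assume \<Gamma>: "is_circle \<Gamma> \<and> \<Gamma> \<inter> interior (convex hull {A, B, C}) = {} \<and>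
      (\<exists>P\<in>open_segment B C. tangent_line_at \<Gamma> P (affine hull {B, C})) \<and>
      (\<exists>Q\<in>affine hull {C, A} - closed_segment C A. tangent_line_at \<Gamma> Q (affine hull {C, A})) \<and>
      (\<exists>R\<in>affine hull {A, B} - closed_segment A B. tangent_line_at \<Gamma> R (affine hull {A, B}))"
  then obtain O' r where G: "\<Gamma> = sphere O' r" unfolding is_circle_def by blast
  obtain P Q R where P: "P \<in> open_segment B C" "tangent_line_at \<Gamma> P (affine hull {B, C})"
    and Q: "Q \<notin> closed_segment C A" "tangent_line_at \<Gamma> Q (affine hull {C, A})"
    and R: "R \<notin> closed_segment A B" "tangent_line_at \<Gamma> R (affine hull {A, B})"
    using \<Gamma> by blast
  obtain t u w where P': "P = B + t *\<^sub>R (C - B)" and Q': "Q = C + u *\<^sub>R (A - C)"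
    and R': "R = A + w *\<^sub>R (B - A)"
    using P(2) Q(2) R(2) tangent_point_param by metis
  note tan = P(2)[unfolded P' G] Q(2)[unfolded Q' G] R(2)[unfolded R' G]
  have "0 < t \<and> t < 1" "u < 0 \<or> 1 < u" "w < 0 \<or> 1 < w"
    using P(1) Q(1) R(1) nz by (auto simp: P' Q' R' segment_point_iff)
  then have "0 < t * a \<and> t * a < a" "u * b < 0 \<or> b < u * b" "w * c < 0 \<or> c < w * c"
    using pos by (simp_all add: mult_less_0_iff)
  moreover have "\<bar>t * a\<bar> = \<bar>c - w * c\<bar>" "\<bar>u * b\<bar> = \<bar>a - t * a\<bar>" "\<bar>w * c\<bar> = \<bar>b - u * b\<bar>"
    using tangent_lengths_eq[OF nz(4,5) tan(1,3)] tangent_lengths_eq[OF nz(5,6) tan(2,1)]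
      tangent_lengths_eq[OF nz(6,4) tan(3,2)] by (simp_all add: d)
  \<comment> \<open>\<open>Q\<close> and \<open>R\<close> can each lie beyond either end of their
    side. Only \<open>Q\<close> beyond \<open>C\<close> and \<open>R\<close> beyond \<open>B\<close>
    is compatible with \<open>a < b + c\<close>; the equations then become linear.\<close>
  ultimately have "2 * (t * a) = a + b - c" "2 * (u * b) = b - a - c" using s by linarith+
  then have "t = (- a + c - b) / (2 * - a)" "u = (b + - a - c) / (2 * b)" using pos by (simp_all add: field_simps)
  then show "\<Gamma> = ?\<Gamma>"
    unfolding G using circle_eq_if_two_contacts[OF nc tan(1,2)] T(1,2) by simp
qed

section \<open>The nine-point circle\<close>

lemma circumcenter_exists:
  fixes A B C :: point
  assumes "\<not> collinear {A, B, C}"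
  obtains O' R where "dist O' A = R" "dist O' B = R" "dist O' C = R"
proof -
  define p where "p = B - A"
  define q where "q = C - A"
  have k: "cross2 p q \<noteq> 0" using noncollinear_cross2[OF assms] by (simp add: p_def q_def)
  \<comment> \<open>Cramer's rule for \<open>2 * (w \<bullet> p) = p \<bullet> p\<close> and
    \<open>2 * (w \<bullet> q) = q \<bullet> q\<close>, the perpendicular bisectors of
    \<open>AB\<close> and \<open>AC\<close> seen from \<open>A\<close>.\<close>
  define w :: point where "w = (1 / (2 * cross2 p q)) *\<^sub>R
    vector [(p \<bullet> p) * q$2 - (q \<bullet> q) * p$2, (q \<bullet> q) * p$1 - (p \<bullet> p) * q$1]"
  have "(2 * cross2 p q) * (w \<bullet> p) = (p \<bullet> p) * cross2 p q"
    "(2 * cross2 p q) * (w \<bullet> q) = (q \<bullet> q) * cross2 p q"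
    using k by (simp_all add: w_def) (simp_all add: plane_coords algebra_simps)
  then have "2 * (w \<bullet> p) = p \<bullet> p" "2 * (w \<bullet> q) = q \<bullet> q" using k by simp_all
  then have "norm (w - p) = norm w" "norm (w - q) = norm w"
    by (simp_all add: norm_eq_sqrt_inner inner_diff_left inner_diff_right inner_commute)
  moreover have "A + w - B = w - p" "A + w - C = w - q" by (simp_all add: p_def q_def)
  ultimately have "dist (A + w) A = norm w" "dist (A + w) B = norm w" "dist (A + w) C = norm w"
    by (simp_all only: dist_norm add_diff_cancel_left')
  then show ?thesis using that by blast
qed

text \<open>The inner product is the difference of the squared distances from \<open>O'\<close> to
  \<open>C\<close> and \<open>B\<close>, factored.\<close>

lemma equidistant_orthogonal:
  assumes "dist O' B = dist O' C"
  shows "(B + C - 2 *\<^sub>R O') \<bullet> (C - B) = 0"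
proof -
  have "(dist O' B)\<^sup>2 = (dist O' C)\<^sup>2" using assms by simp
  then show ?thesis
    unfolding dist_sq_inner by (simp add: algebra_simps inner_commute)
qed

text \<open>With the circumcenter as origin this is \<open>H = A + B + C\<close>: then
  \<open>H - A = B + C\<close> is perpendicular to \<open>BC\<close> because \<open>B\<close> and
  \<open>C\<close> are equidistant from the origin.\<close>

lemma orthocenter_eq:
  fixes A B C :: point
  assumes nc: "\<not> collinear {A, B, C}" and R: "dist O' A = R" "dist O' B = R" "dist O' C = R"
  shows "orthocenter A B C = A + B + C - 2 *\<^sub>R O'"
  unfolding orthocenter_def altitude_def orthogonal_def mem_Collect_eq
proof (rule the_equality)
  let ?H = "A + B + C - 2 *\<^sub>R O'"
  have eq: "?H - A = B + C - 2 *\<^sub>R O'" "?H - B = C + A - 2 *\<^sub>R O'" "?H - C = A + B - 2 *\<^sub>R O'"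
    by simp_all
  show H: "(?H - A) \<bullet> (C - B) = 0 \<and> (?H - B) \<bullet> (A - C) = 0 \<and> (?H - C) \<bullet> (B - A) = 0"
    unfolding eq using equidistant_orthogonal R by metis
  fix X assume X: "(X - A) \<bullet> (C - B) = 0 \<and> (X - B) \<bullet> (A - C) = 0 \<and> (X - C) \<bullet> (B - A) = 0"
  have "cross2 (C - B) (A - C) \<noteq> 0"
    using noncollinear_cross2[OF noncollinear_perm[OF noncollinear_perm[OF nc]]]
    by (simp add: plane_coords algebra_simps)
  moreover have "X - ?H = (X - A) - (?H - A)" "X - ?H = (X - B) - (?H - B)" by simp_all
  then have "(X - ?H) \<bullet> (C - B) = 0" "(X - ?H) \<bullet> (A - C) = 0"
    using X H by (metis diff_self inner_diff_left)+
  ultimately show "X = ?H" by (rule eq_if_orthogonal_to_two)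
qed

text \<open>On the line \<open>BC\<close> the altitude condition is linear in the parameter with
  nonzero leading coefficient, so the definite description denotes.\<close>

lemma altitude_foot:
  assumes "B \<noteq> C"
  shows "altitude_foot A B C \<in> altitude A B C" "altitude_foot A B C \<in> affine hull {B, C}"
proof -
  have nz: "(C - B) \<bullet> (C - B) \<noteq> 0" using assms by simp
  let ?t = "(A - B) \<bullet> (C - B) / ((C - B) \<bullet> (C - B))"
  have iff: "B + t *\<^sub>R (C - B) \<in> altitude A B C \<longleftrightarrow> t = ?t" for t
  proof -
    have "(B + t *\<^sub>R (C - B) - A) \<bullet> (C - B) = t * ((C - B) \<bullet> (C - B)) - (A - B) \<bullet> (C - B)"
      by (simp add: inner_diff_left inner_add_left)
    then show ?thesis using nz unfolding altitude_def orthogonal_def mem_Collect_eq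
      by (simp add: nonzero_eq_divide_eq)
  qed
  have "\<exists>!F. F \<in> altitude A B C \<and> F \<in> affine hull {B, C}"
    unfolding affine_hull_2_alt
  proof (rule ex1I)
    show "B + ?t *\<^sub>R (C - B) \<in> altitude A B C \<and> B + ?t *\<^sub>R (C - B) \<in> range (\<lambda>u. B + u *\<^sub>R (C - B))"
      using iff by blast
    fix F assume "F \<in> altitude A B C \<and> F \<in> range (\<lambda>u. B + u *\<^sub>R (C - B))"
    then show "F = B + ?t *\<^sub>R (C - B)" using iff by auto
  qed
  then show "altitude_foot A B C \<in> altitude A B C" "altitude_foot A B C \<in> affine hull {B, C}"
    unfolding altitude_foot_def by (metis (mono_tags, lifting) theI')+
qed

text \<open>The three points belonging to \<open>A\<close>; the other six follow by relabelling. The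
  two midpoints are opposite ends of a diameter, at \<open>N\<close> minus and plus half of
  \<open>A - O'\<close>.\<close>

lemma nine_points_on_sphere:
  fixes A B C :: point
  assumes nc: "\<not> collinear {A, B, C}" and R: "dist O' A = R" "dist O' B = R" "dist O' C = R"
    and N: "N = (1 / 2) *\<^sub>R (A + B + C - O')"
  shows "midpoint B C \<in> sphere N (R / 2)" "altitude_foot A B C \<in> sphere N (R / 2)"
    "midpoint (orthocenter A B C) A \<in> sphere N (R / 2)"
proof -
  have bc: "B \<noteq> C" using noncollinear_distinct[OF nc] by simp
  define M where "M = midpoint B C"
  define F where "F = altitude_foot A B C"
  have "N - M = (1 / 2) *\<^sub>R (A - O')"
    by (simp add: N M_def midpoint_def algebra_simps)
  then have NM: "dist N M = R / 2" using R by (simp add: dist_norm norm_minus_commute)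
  then show "midpoint B C \<in> sphere N (R / 2)" by (simp add: M_def)
  have "midpoint (orthocenter A B C) A - N = (1 / 2) *\<^sub>R (A - O')"
    by (simp add: N orthocenter_eq[OF nc R] midpoint_def point_eq_iff field_simps)
  then show "midpoint (orthocenter A B C) A \<in> sphere N (R / 2)"
    using R by (simp add: dist_norm norm_minus_commute[of N] norm_minus_commute[of A])
  \<comment> \<open>\<open>N\<close> is the midpoint of \<open>O'\<close> and the orthocenter, so it projects to the midpoint of \<open>M\<close> and \<open>F\<close>\<close>
  obtain f where f: "F = B + f *\<^sub>R (C - B)"
    using altitude_foot(2)[OF bc, of A] unfolding affine_hull_2_alt F_def by auto
  have FA: "(F - A) \<bullet> (C - B) = 0"
    using altitude_foot(1)[OF bc, of A] by (simp add: altitude_def orthogonal_def F_def)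
  have NFM: "2 *\<^sub>R (2 *\<^sub>R N - F - M) = (B + C - 2 *\<^sub>R O') - 2 *\<^sub>R (F - A)"
    by (simp add: N M_def midpoint_def point_eq_iff field_simps)
  have eo: "(B + C - 2 *\<^sub>R O') \<bullet> (C - B) = 0"
    using equidistant_orthogonal R by metis
  have "2 * ((2 *\<^sub>R N - F - M) \<bullet> (C - B)) = (2 *\<^sub>R (2 *\<^sub>R N - F - M)) \<bullet> (C - B)"
    by (simp only: inner_scaleR_left)
  also have "\<dots> = 0"
    unfolding NFM by (subst inner_diff_left) (simp only: inner_scaleR_left FA eo mult_zero_right diff_self)
  finally have "(2 *\<^sub>R N - F - M) \<bullet> (C - B) = 0" by simp
  moreover have "M - F = (1 / 2 - f) *\<^sub>R (C - B)"
    by (simp add: f M_def midpoint_def point_eq_iff field_simps)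
  \<comment> \<open>This product is the difference of the squared distances from \<open>N\<close> to
    \<open>F\<close> and to \<open>M\<close>.\<close>
  ultimately have "(2 *\<^sub>R N - F - M) \<bullet> (M - F) = 0" by simp
  then have "(dist N F)\<^sup>2 = (dist N M)\<^sup>2"
    unfolding dist_sq_inner by (simp add: algebra_simps inner_commute)
  then have "dist N F = dist N M" by (metis power2_eq_imp_eq zero_le_dist)
  then show "altitude_foot A B C \<in> sphere N (R / 2)"
    using NM by (simp add: F_def)
qed

lemma nine_point_circle_eq:
  fixes A B C :: point
  assumes nc: "\<not> collinear {A, B, C}" and R: "dist O' A = R" "dist O' B = R" "dist O' C = R"
  shows "nine_point_circle A B C = sphere ((1 / 2) *\<^sub>R (A + B + C - O')) (R / 2)"
  unfolding nine_point_circle_def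
proof (rule the_equality)
  define N where "N = (1 / 2) *\<^sub>R (A + B + C - O')"
  note nc' = noncollinear_perm[OF nc] and nc'' = noncollinear_perm[OF noncollinear_perm[OF nc]]
  have N': "N = (1 / 2) *\<^sub>R (B + C + A - O')" "N = (1 / 2) *\<^sub>R (C + A + B - O')"
    by (simp_all add: N_def add_ac)
  have H: "orthocenter B C A = orthocenter A B C" "orthocenter C A B = orthocenter A B C"
    using orthocenter_eq[OF nc R] orthocenter_eq[OF nc' R(2,3,1)] orthocenter_eq[OF nc'' R(3,1,2)]
    by (simp_all add: add_ac)
  note on = nine_points_on_sphere[OF nc R N_def] nine_points_on_sphere[OF nc' R(2,3,1) N'(1)]
    nine_points_on_sphere[OF nc'' R(3,1,2) N'(2)]
  have "R > 0" using R noncollinear_distinct[OF nc] by (metis dist_eq_0_iff zero_le_dist order_le_less)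
  then have "is_circle (sphere N (R / 2))" unfolding is_circle_def by (metis half_gt_zero)
  then show "is_circle (sphere N (R / 2)) \<and>
      {midpoint B C, midpoint C A, midpoint A B} \<subseteq> sphere N (R / 2) \<and>
      {altitude_foot A B C, altitude_foot B C A, altitude_foot C A B} \<subseteq> sphere N (R / 2) \<and>
      {midpoint (orthocenter A B C) A, midpoint (orthocenter A B C) B,
       midpoint (orthocenter A B C) C} \<subseteq> sphere N (R / 2)"
    using on by (simp add: H)
  fix \<Gamma> assume \<Gamma>: "is_circle \<Gamma> \<and>
      {midpoint B C, midpoint C A, midpoint A B} \<subseteq> \<Gamma> \<and>
      {altitude_foot A B C, altitude_foot B C A, altitude_foot C A B} \<subseteq> \<Gamma> \<and>
      {midpoint (orthocenter A B C) A, midpoint (orthocenter A B C) B,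
       midpoint (orthocenter A B C) C} \<subseteq> \<Gamma>"
  then obtain X r where G: "\<Gamma> = sphere X r" unfolding is_circle_def by blast
  \<comment> \<open>The difference of two centers is orthogonal to every common chord. The chords
    joining side midpoints are parallel to the sides, which gives two independent
    directions.\<close>
  have eqd: "(X - N) \<bullet> (V - U) = 0" if "dist X U = dist X V" "dist N U = dist N V" for U V
    using equidistant_orthogonal[OF that(1)] equidistant_orthogonal[OF that(2)]
    by (simp add: inner_diff_left)
  have "dist X (midpoint B C) = dist X (midpoint C A)" "dist X (midpoint C A) = dist X (midpoint A B)"
    using \<Gamma> by (auto simp: G)
  moreover have "dist N (midpoint B C) = dist N (midpoint C A)" "dist N (midpoint C A) = dist N (midpoint A B)"
    using on by auto
  ultimately have "(X - N) \<bullet> (midpoint C A - midpoint B C) = 0" "(X - N) \<bullet> (midpoint A B - midpoint C A) = 0"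
    using eqd by blast+
  moreover have "midpoint C A - midpoint B C = (1 / 2) *\<^sub>R (A - B)" "midpoint A B - midpoint C A = (1 / 2) *\<^sub>R (B - C)"
    by (simp_all add: midpoint_def algebra_simps)
  ultimately have "(X - N) \<bullet> (A - B) = 0" "(X - N) \<bullet> (B - C) = 0" by simp_all
  moreover have "cross2 (A - B) (B - C) \<noteq> 0"
    using noncollinear_cross2[OF nc] by (simp add: plane_coords algebra_simps)
  ultimately have "X = N" using eq_if_orthogonal_to_two by blast
  then show "\<Gamma> = sphere N (R / 2)" using \<Gamma> on by (auto simp: G)
qed

section \<open>Feuerbach's theorem\<close>

text \<open>This is \<open>2kR = abc\<close> squared, a form that is blind to the signs of the
  sides.\<close>

lemma circumradius_formula:
  assumes S: "signed_sides A B C a b c" and R: "dist O' A = R" "dist O' B = R" "dist O' C = R"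
  shows "4 * (cross2 (B - A) (C - A))\<^sup>2 * R\<^sup>2 = (a * b * c)\<^sup>2"
proof -
  define p where "p = B - A"
  define q where "q = C - A"
  define w where "w = O' - A"
  have "O' - B = w - p" "O' - C = w - q" "(dist O' A)\<^sup>2 = w \<bullet> w"
    by (simp_all add: p_def q_def w_def dist_sq_inner)
  then have "(w - p) \<bullet> (w - p) = w \<bullet> w" "(w - q) \<bullet> (w - q) = w \<bullet> w" and wR: "w \<bullet> w = R\<^sup>2"
    using R by (metis dist_sq_inner)+
  note sq = signed_sides_sq[OF S, folded p_def q_def]
  have wpq: "2 * (w \<bullet> p) = c\<^sup>2" "2 * (w \<bullet> q) = b\<^sup>2"
    using \<open>(w - p) \<bullet> (w - p) = w \<bullet> w\<close> \<open>(w - q) \<bullet> (w - q) = w \<bullet> w\<close> sq(2,3)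
    by (simp_all add: inner_diff_left inner_diff_right inner_commute)
  \<comment> \<open>The Gram determinant of the three plane vectors \<open>w\<close>,
    \<open>p\<close>, \<open>q\<close> vanishes; every inner product in it is known from the sides
    and \<open>R\<close>.\<close>
  have "(cross2 p q)\<^sup>2 * (w \<bullet> w) =
      (w \<bullet> p)\<^sup>2 * (q \<bullet> q) - 2 * (w \<bullet> p) * (w \<bullet> q) * (p \<bullet> q) + (w \<bullet> q)\<^sup>2 * (p \<bullet> p)"
    by (simp add: plane_coords power2_eq_square algebra_simps)
  then show ?thesis
    using sq wpq wR unfolding p_def[symmetric] q_def[symmetric] by algebra
qed

text \<open>The identity behind all four tangencies, squared so that the sign of
  \<open>\<rho> - r\<close> does not matter. Scaling \<open>N - J\<close> by \<open>2 * s\<close>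
  clears the denominators.\<close>

lemma nine_point_center_dist:
  assumes S: "signed_sides A B C a b c" and R: "dist O' A = R" "dist O' B = R" "dist O' C = R"
  defines "\<rho> \<equiv> a * b * c / (4 * \<bar>cross2 (B - A) (C - A)\<bar>)"
  shows "\<bar>\<rho>\<bar> = R / 2"
    and "(dist ((1 / 2) *\<^sub>R (A + B + C - O')) (tri_center A B C a b c))\<^sup>2 = (\<rho> - tri_radius A B C a b c)\<^sup>2"
proof -
  define k where "k = \<bar>cross2 (B - A) (C - A)\<bar>"
  define s where "s = a + b + c"
  define N where "N = (1 / 2) *\<^sub>R (A + B + C - O')"
  define J where "J = tri_center A B C a b c"
  define r where "r = tri_radius A B C a b c"
  have k: "k > 0" using signed_sides_nonzero[OF S] by (simp add: k_def)
  have s: "s > 0" using S by (simp add: signed_sides_def s_def)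
  have \<rho>: "4 * k * \<rho> = a * b * c" using k by (simp add: \<rho>_def k_def)
  have kR: "4 * k\<^sup>2 * R\<^sup>2 = (a * b * c)\<^sup>2"
    using circumradius_formula[OF S R] by (simp add: k_def)
  have "4 * k\<^sup>2 * (2 * \<rho>)\<^sup>2 = (4 * k * \<rho>)\<^sup>2"
    by (simp add: power2_eq_square)
  then have "4 * k\<^sup>2 * (2 * \<rho>)\<^sup>2 = 4 * k\<^sup>2 * R\<^sup>2"
    using kR \<rho> by simp
  then have \<rho>R: "(2 * \<rho>)\<^sup>2 = R\<^sup>2" using k by simp
  then have "\<bar>2 * \<rho>\<bar> = \<bar>R\<bar>" by (simp only: power2_eq_iff abs_eq_iff)
  moreover have "R \<ge> 0" using R by auto
  ultimately show "\<bar>\<rho>\<bar> = R / 2" by simp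
  have sr: "s * r = k" using s by (simp add: r_def tri_radius_def k_def s_def)
  define u where "u = A - O'"
  define v where "v = B - O'"
  define w where "w = C - O'"
  have sq: "u \<bullet> u = R\<^sup>2" "v \<bullet> v = R\<^sup>2" "w \<bullet> w = R\<^sup>2"
    unfolding u_def v_def w_def dist_sq_inner[symmetric] using R by (simp_all add: dist_commute)
  have "B - A = v - u" "C - A = w - u" "C - B = w - v" by (simp_all add: u_def v_def w_def)
  then have uv: "2 * (u \<bullet> v) = 2 * R\<^sup>2 - c\<^sup>2" "2 * (u \<bullet> w) = 2 * R\<^sup>2 - b\<^sup>2" "2 * (v \<bullet> w) = 2 * R\<^sup>2 - a\<^sup>2"
    using signed_sides_sq(1-3)[OF S] sq
    by (simp_all add: inner_diff_left inner_diff_right inner_commute)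
  have sJ: "s *\<^sub>R J = a *\<^sub>R A + b *\<^sub>R B + c *\<^sub>R C"
    using s by (simp add: J_def tri_center_def s_def scaleR_add_right)
  have "(2 * s) *\<^sub>R (N - J) = s *\<^sub>R (A + B + C - O') - 2 *\<^sub>R (s *\<^sub>R J)"
    by (simp add: N_def scaleR_diff_right)
  also have "\<dots> = (s - 2 * a) *\<^sub>R u + (s - 2 * b) *\<^sub>R v + (s - 2 * c) *\<^sub>R w"
    unfolding sJ by (simp add: s_def u_def v_def w_def point_eq_iff algebra_simps)
  finally have NJ: "(2 * s) *\<^sub>R (N - J) = (s - 2 * a) *\<^sub>R u + (s - 2 * b) *\<^sub>R v + (s - 2 * c) *\<^sub>R w" .
  have "4 * s\<^sup>2 * (dist N J)\<^sup>2 = ((2 * s) *\<^sub>R (N - J)) \<bullet> ((2 * s) *\<^sub>R (N - J))"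
    unfolding dist_sq_inner by (simp add: power2_eq_square)
  also have "\<dots> = (s - 2 * a)\<^sup>2 * (u \<bullet> u) + (s - 2 * b)\<^sup>2 * (v \<bullet> v) + (s - 2 * c)\<^sup>2 * (w \<bullet> w)
      + (s - 2 * a) * (s - 2 * b) * (2 * (u \<bullet> v)) + (s - 2 * a) * (s - 2 * c) * (2 * (u \<bullet> w))
      + (s - 2 * b) * (s - 2 * c) * (2 * (v \<bullet> w))"
    unfolding NJ inner_add_left inner_add_right inner_scaleR_left inner_scaleR_right
    by (simp add: inner_commute power2_eq_square algebra_simps)
  \<comment> \<open>The weights \<open>s - 2 * a\<close>, \<open>s - 2 * b\<close>,
    \<open>s - 2 * c\<close> add up to \<open>s\<close>, so the terms in \<open>R\<close> collect to
    \<open>s\<^sup>2 * R\<^sup>2\<close>.\<close>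
  also have "\<dots> = s\<^sup>2 * R\<^sup>2 - 2 * (a * b * c) * s + s * (b + c - a) * (c + a - b) * (a + b - c)"
    unfolding sq uv s_def by algebra
  also have "\<dots> = s\<^sup>2 * R\<^sup>2 - 2 * (a * b * c) * s + 4 * k\<^sup>2"
    using heron[OF S] by (simp add: s_def k_def)
  \<comment> \<open>Substituting \<open>R\<^sup>2 = (2 * \<rho>)\<^sup>2\<close>,
    \<open>abc = 4 * k * \<rho>\<close> and \<open>k = s * r\<close> produces a perfect
    square.\<close>
  also have "\<dots> = 4 * s\<^sup>2 * (\<rho> - r)\<^sup>2"
    unfolding \<rho>R[symmetric] \<rho>[symmetric] sr[symmetric] by (simp add: power2_eq_square algebra_simps)
  finally show "(dist N J)\<^sup>2 = (\<rho> - r)\<^sup>2" using s by simp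
qed

section \<open>The tangencies\<close>

text \<open>Here \<open>\<rho>\<close> is negative, so \<open>\<rho> - r\<close> cannot vanish: the
  centers differ in every triangle and the tangency is external.\<close>

lemma nine_point_circle_tangent_excircle:
  fixes A B C :: point
  assumes nc: "\<not> collinear {A, B, C}" and R: "dist O' A = R" "dist O' B = R" "dist O' C = R"
  shows "circles_tangent (nine_point_circle A B C) (excircle A B C)"
proof -
  define a where "a = dist B C"
  define b where "b = dist C A"
  define c where "c = dist A B"
  have pos: "a > 0" "b > 0" "c > 0"
    using noncollinear_distinct[OF nc] by (simp_all add: a_def b_def c_def)
  have S1: "signed_sides A B C a b c"
    using nc add_pos_pos[OF add_pos_pos[OF pos(1,2)] pos(3)]
    by (simp add: signed_sides_def a_def b_def c_def)
  \<comment> \<open>Heron's formula excludes equality in the triangle inequality, which yields the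
    positive signed perimeter for \<open>-a, b, c\<close>.\<close>
  have "b + c \<noteq> a" using heron[OF S1] signed_sides_nonzero(7)[OF S1] by auto
  moreover have "a \<le> b + c"
    using dist_triangle[of B C A] by (simp add: a_def b_def c_def dist_commute)
  ultimately have S: "signed_sides A B C (-a) b c"
    using S1 unfolding signed_sides_def by simp
  define N where "N = (1 / 2) *\<^sub>R (A + B + C - O')"
  define J where "J = tri_center A B C (-a) b c"
  define r where "r = tri_radius A B C (-a) b c"
  define \<rho> where "\<rho> = - a * b * c / (4 * \<bar>cross2 (B - A) (C - A)\<bar>)"
  note nz = signed_sides_nonzero[OF S]
  have \<rho>: "\<rho> < 0" using pos nz(7) by (simp add: \<rho>_def)
  have r: "r > 0" using nz by (simp add: r_def)
  note D = nine_point_center_dist[OF S R, folded \<rho>_def N_def J_def r_def]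
  have "N \<noteq> J" using D(2) \<rho> r by auto
  then have "circles_tangent (sphere N \<bar>\<rho>\<bar>) (sphere J r)"
    using spheres_tangentI[OF D(2)] r \<rho> by simp
  then show ?thesis
    unfolding D(1) nine_point_circle_eq[OF nc R] excircle_eq[OF S pos] N_def J_def r_def .
qed

text \<open>Both circles coincide, so the midpoint of \<open>BC\<close> is a common point of the
  circle and its tangent \<open>BC\<close>. It must be the contact point, whose parameter is
  therefore \<open>1 / 2\<close>.\<close>

lemma concentric_imp_isosceles:
  assumes S: "signed_sides A B C a b c" and R: "dist O' A = R" "dist O' B = R" "dist O' C = R"
    and J: "(1 / 2) *\<^sub>R (A + B + C - O') = tri_center A B C a b c"
    and r: "tri_radius A B C a b c = R / 2"
  shows "b = c"
proof -
  note nz = signed_sides_nonzero[OF S]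
  have nc: "\<not> collinear {A, B, C}" using S by (simp add: signed_sides_def)
  have "midpoint B C \<in> sphere (tri_center A B C a b c) (tri_radius A B C a b c)"
    using nine_points_on_sphere(1)[OF nc R refl] unfolding J r .
  moreover have M: "midpoint B C = B + (1 / 2) *\<^sub>R (C - B)"
    by (simp add: midpoint_def point_eq_iff field_simps)
  then have "midpoint B C \<in> affine hull {B, C}"
    unfolding affine_hull_2_alt by blast
  ultimately have "B + (1 / 2) *\<^sub>R (C - B) = B + ((a + c - b) / (2 * a)) *\<^sub>R (C - B)"
    using tri_center_tangent[OF S] unfolding tangent_line_at_def M by blast
  then have "1 / 2 = (a + c - b) / (2 * a)" using nz(5) by simp
  then show ?thesis using nz(1) by (simp add: field_simps)
qed

lemma nine_point_circle_tangent_incircle: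
  fixes A B C :: point
  assumes nc: "\<not> collinear {A, B, C}" and ne: "\<not> equilateral A B C"
    and R: "dist O' A = R" "dist O' B = R" "dist O' C = R"
  shows "circles_tangent (nine_point_circle A B C) (incircle A B C)"
proof -
  define a where "a = dist B C"
  define b where "b = dist C A"
  define c where "c = dist A B"
  have pos: "a > 0" "b > 0" "c > 0"
    using noncollinear_distinct[OF nc] by (simp_all add: a_def b_def c_def)
  have S: "signed_sides A B C a b c"
    using nc add_pos_pos[OF add_pos_pos[OF pos(1,2)] pos(3)]
    by (simp add: signed_sides_def a_def b_def c_def)
  define N where "N = (1 / 2) *\<^sub>R (A + B + C - O')"
  define J where "J = tri_center A B C a b c"
  define r where "r = tri_radius A B C a b c"
  define \<rho> where "\<rho> = a * b * c / (4 * \<bar>cross2 (B - A) (C - A)\<bar>)"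
  note nz = signed_sides_nonzero[OF S]
  have \<rho>: "\<rho> > 0" using pos nz(7) by (simp add: \<rho>_def)
  have r: "r > 0" using nz by (simp add: r_def)
  note D = nine_point_center_dist[OF S R, folded \<rho>_def N_def J_def r_def]
  have "N \<noteq> J"
  proof
    assume NJ: "N = J"
    \<comment> \<open>Zero distance forces \<open>\<rho> = r\<close>, and \<open>\<rho>\<close> is
      half the circumradius up to sign.\<close>
    then have rR: "r = R / 2" using D \<rho> by simp
    have "b = c"
      using concentric_imp_isosceles[OF S R] NJ rR by (simp add: N_def J_def r_def)
    moreover have "c = a"
      using concentric_imp_isosceles[OF signed_sides_rotate[OF S] R(2,3,1)] NJ rR
      by (simp add: N_def J_def r_def tri_rotate[where A = A and B = B and C = C and a = a and b = b and c = c] add_ac)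
    ultimately show False
      using ne by (simp add: equilateral_def a_def b_def c_def)
  qed
  then have "circles_tangent (sphere N \<bar>\<rho>\<bar>) (sphere J r)"
    using spheres_tangentI[OF D(2)] r \<rho> by simp
  then show ?thesis
    unfolding D(1) nine_point_circle_eq[OF nc R] incircle_eq[OF S pos] N_def J_def r_def .
qed

theorem mainTheorem2:
  fixes A B C :: point
  assumes "\<not> collinear {A, B, C}"
    and "\<not> equilateral A B C"
  shows "circles_tangent (nine_point_circle A B C) (incircle A B C) \<and>
    circles_tangent (nine_point_circle A B C) (excircle A B C) \<and>
    circles_tangent (nine_point_circle A B C) (excircle B C A) \<and>
    circles_tangent (nine_point_circle A B C) (excircle C A B)"
proof -
  obtain O' R where R: "dist O' A = R" "dist O' B = R" "dist O' C = R"
    using circumcenter_exists[OF assms(1)] .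
  note nc = assms(1) noncollinear_perm[OF assms(1)] noncollinear_perm[OF noncollinear_perm[OF assms(1)]]
  \<comment> \<open>The other two excircles come from the relabelled triangles, which share the
    nine-point circle.\<close>
  have "nine_point_circle B C A = nine_point_circle A B C" "nine_point_circle C A B = nine_point_circle A B C"
    using nine_point_circle_eq[OF nc(1) R] nine_point_circle_eq[OF nc(2) R(2,3,1)]
      nine_point_circle_eq[OF nc(3) R(3,1,2)] by (simp_all add: add_ac)
  then show ?thesis
    using nine_point_circle_tangent_incircle[OF assms R]
      nine_point_circle_tangent_excircle[OF nc(1) R] nine_point_circle_tangent_excircle[OF nc(2) R(2,3,1)]
      nine_point_circle_tangent_excircle[OF nc(3) R(3,1,2)] by simp
qed

end
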